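(* Let $d\ge1$ and $1\le p<q=\tfrac{d+2}{d}p'$. If $p\ge2$, then $\alpha_{p,q}=\beta_{p,q}$; if $p<2$, then $\alpha_{p,q}<\beta_{p,q}$.
   Context: $p'$ denotes the conjugate exponent of $p$ (and $r'$ that of $r$). For $1\le p<q=\tfrac{d+2}{d}p'$ define $$\alpha_{p,q}:=\max_{t\in[0,1]}\frac{\|1+te^{i\theta}\|_{L^q([0,2\pi],d\theta/2\pi)}}{(1+t^p)^{1/p}},\qquad \beta_{p,q}:=2^{\frac1{r'}}\left(\frac{\Gamma(\frac{q+1}2)}{\sqrt\pi\,\Gamma(\frac{q+2}2)}\right)^{\frac1q},\qquad r:=\max\{p,2\}.$$ When $p=1$, so $q=\infty$, the factor $(\cdots)^{1/q}$ in $\beta_{p,q}$ is read as its limit as $q\to\infty$, namely $1$. *)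

theory Defs
  imports "HOL-Probability.Probability"
begin

text \<open>Only finite \<open>p \<ge> 1\<close> occur as arguments; the value is infinite precisely when \<open>p = 1\<close>.\<close>

definition conj_exponent :: "real \<Rightarrow> ereal" where
  "conj_exponent p = (if p = 1 then \<infinity> else ereal (p / (p - 1)))"

text \<open>The \<open>L\<^sup>q\<close> norm for exponents \<open>0 < q \<le> \<infinity>\<close>. The norm is taken to be real-valued, so it is only
  meaningful for functions in \<open>L\<^sup>q\<close>; below it is applied to bounded continuous functions on a
  probability space.\<close>

definition Lq_norm :: "'a measure \<Rightarrow> ereal \<Rightarrow> ('a \<Rightarrow> complex) \<Rightarrow> real" where
  "Lq_norm M q f =
     (if q = \<infinity> then real_of_ereal (esssup M (\<lambda>x. ereal (norm (f x))))
      else (\<integral>x. norm (f x) powr real_of_ereal q \<partial>M) powr (1 / real_of_ereal q))"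

text \<open>The interval from \<open>0\<close> to \<open>2 * pi\<close> with the measure \<open>d\<theta> / (2 * pi)\<close>.\<close>

definition circle_measure :: "real measure" where
  "circle_measure = uniform_measure lborel {0..2 * pi}"

text \<open>\<open>Greatest\<close> rather than a supremum, because the maximum is part of the definition
  (\<open>Max\<close> is restricted to finite sets).\<close>

definition alpha :: "real \<Rightarrow> ereal \<Rightarrow> real" where
  "alpha p q =
     (GREATEST a. a \<in> (\<lambda>t. Lq_norm circle_measure q (\<lambda>\<theta>. 1 + of_real t * exp (\<i> * of_real \<theta>))
                             / (1 + t powr p) powr (1 / p)) ` {0..1})"

text \<open>For \<open>q = \<infinity>\<close> the factor with exponent \<open>1 / q\<close> is read as its limit \<open>1\<close>.\<close>

definition beta_factor :: "ereal \<Rightarrow> real" where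
  "beta_factor q =
     (if q = \<infinity> then 1
      else (Gamma ((real_of_ereal q + 1) / 2) / (sqrt pi * Gamma ((real_of_ereal q + 2) / 2)))
             powr (1 / real_of_ereal q))"

definition beta :: "real \<Rightarrow> ereal \<Rightarrow> real" where
  "beta p q = 2 powr (1 / real_of_ereal (conj_exponent (max p 2))) * beta_factor q"

end

theory Submission
  imports Defs
begin

text \<open>For \<open>q < \<infinity>\<close> the proof rests on the factorisation
  \<open>\<bar>1 + t e\<^sup>i\<^sup>\<theta>\<bar>\<^sup>2 = (1 + t\<^sup>2) (1 + s cos \<theta>)\<close> with \<open>s = 2t / (1 + t\<^sup>2) \<in> [0, 1]\<close>. It turns the
  \<open>L\<^sup>q\<close> norm on the circle into \<open>(1 + t\<^sup>2)\<^sup>1\<^sup>/\<^sup>2 F(s)\<^sup>1\<^sup>/\<^sup>q\<close>, where \<open>F(s)\<close> is the mean of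
  \<open>(1 + s cos \<theta>)\<^sup>q\<^sup>/\<^sup>2\<close>. The hypotheses imply \<open>q > 2\<close>, so that \<open>x\<^sup>q\<^sup>/\<^sup>2\<close> is
  strictly convex. As \<open>F\<close> is convex and, by the symmetry
  \<open>\<theta> \<mapsto> \<pi> - \<theta>\<close>, even, it is largest on \<open>[0, 1]\<close> at \<open>s = 1\<close>, that is at \<open>t = 1\<close>, and only there
  (\<open>cos_mean_less\<close>). The value \<open>F(1)\<close> is a Beta integral, and \<open>F(1)\<^sup>1\<^sup>/\<^sup>q = \<surd>2 B\<close> with \<open>B\<close> the
  Gamma factor of \<open>\<beta>\<close> (\<open>cos_mean_1\<close>).

  So the norm is at most \<open>(1 + t\<^sup>2)\<^sup>1\<^sup>/\<^sup>2 \<surd>2 B\<close>, with equality at \<open>t = 1\<close>. It remains to compare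
  \<open>(1 + t\<^sup>2)\<^sup>1\<^sup>/\<^sup>2\<close> with \<open>(1 + t\<^sup>p)\<^sup>1\<^sup>/\<^sup>p\<close>. If \<open>p \<ge> 2\<close>, the power mean inequality says that their quotient
  is maximal at \<open>t = 1\<close>; hence so is the quotient defining \<open>\<alpha>\<close>, and its value there is \<open>\<beta>\<close>. If \<open>p < 2\<close>,
  the quotient is at most \<open>1\<close> because the \<open>l\<^sup>p\<close> norms decrease in \<open>p\<close>, which gives the bound
  \<open>\<surd>2 B = \<beta>\<close>. The bound is strict at every \<open>t\<close>: for \<open>t < 1\<close> the estimate of \<open>F\<close> is strict, and at
  \<open>t = 1\<close> the quotient is \<open>2\<^sup>1\<^sup>/\<^sup>2\<^sup>-\<^sup>1\<^sup>/\<^sup>p < 1\<close>. Strictness passes to \<open>\<alpha>\<close> because the maximum is attained.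

  For \<open>p = 1\<close>, where \<open>q = \<infinity>\<close>, the triangle inequality bounds the quotient by \<open>1\<close>, its value at
  \<open>t = 0\<close>, so that \<open>\<alpha> = 1 < \<surd>2 = \<beta>\<close>.\<close>

section \<open>Convexity inequalities for real powers\<close>

text \<open>The endpoint \<open>0\<close>, where the second derivative test is not available, is needed because
  \<open>1 + cos \<theta>\<close> vanishes at \<open>\<pi>\<close>.\<close>

lemma powr_convex_nonneg:
  assumes "1 \<le> a"
  shows "convex_on {0::real..} (\<lambda>x. x powr a)"
proof (rule convex_onI)
  fix u x y :: real
  assume u: "0 < u" "u < 1" and x: "x \<in> {0..}" and y: "y \<in> {0..}"
  have shrink: "(v * z) powr a \<le> v * z powr a" if "0 < v" "v < 1" "0 \<le> z" for v z :: real
  proof -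
    have "v powr a \<le> v powr 1"
      using that assms by (intro powr_mono') auto
    then show ?thesis
      using that by (simp add: powr_mult mult_right_mono)
  qed
  consider "x = 0" | "y = 0" | "0 < x" "0 < y"
    using x y by force
  then show "((1 - u) *\<^sub>R x + u *\<^sub>R y) powr a \<le> (1 - u) * x powr a + u * y powr a"
  proof cases
    case 3
    then show ?thesis
      using convex_onD[OF powr_convex[OF assms], of u x y] u by simp
  qed (use shrink[of u y] shrink[of "1 - u" x] u x y in auto)
qed simp

lemma powr_half_sum_le:
  fixes x y a :: real
  assumes "1 \<le> a" "0 \<le> x" "0 \<le> y"
  shows "((x + y) / 2) powr a \<le> (x powr a + y powr a) / 2"
  using convex_onD[OF powr_convex_nonneg[OF assms(1)], of "1/2" x y] assms
  by (simp add: field_simps)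

text \<open>The power is superadditive: in \<open>(1 + x)\<^sup>b = (1 + x)\<^sup>b\<^sup>-\<^sup>1 + x (1 + x)\<^sup>b\<^sup>-\<^sup>1\<close> bound the base \<open>1 + x\<close>
  from below by \<open>1\<close> in the first term and by \<open>x\<close> in the second.\<close>

lemma one_plus_powr_le:
  fixes x b :: real
  assumes "0 \<le> x" "1 \<le> b"
  shows "1 + x powr b \<le> (1 + x) powr b"
proof (cases "x = 0")
  case False
  with assms have x: "0 < x" by simp
  have "x powr (b - 1) \<le> (1 + x) powr (b - 1)" "1 \<le> (1 + x) powr (b - 1)"
    using assms x by (auto intro: powr_mono2 ge_one_powr_ge_zero)
  then have "1 + x * x powr (b - 1) \<le> (1 + x) powr (b - 1) + x * (1 + x) powr (b - 1)"
    using x by (intro add_mono mult_left_mono) auto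
  also have "\<dots> = (1 + x) powr b"
    using x powr_mult_base[of "1 + x" "b - 1"] by (simp add: algebra_simps)
  also have "x * x powr (b - 1) = x powr b"
    using x powr_mult_base[of x "b - 1"] by simp
  finally show ?thesis .
qed (use assms in auto)

text \<open>Superadditivity with exponent \<open>2/p \<ge> 1\<close>, applied to \<open>x = t\<^sup>p\<close>.\<close>

lemma l2_norm_le_lp_norm:
  fixes p t :: real
  assumes "0 < p" "p \<le> 2" "0 \<le> t"
  shows "sqrt (1 + t\<^sup>2) \<le> (1 + t powr p) powr (1/p)"
proof -
  have "1 + t\<^sup>2 = 1 + (t powr p) powr (2/p)"
    using assms by (cases "t = 0") (auto simp: powr_powr)
  also have "\<dots> \<le> (1 + t powr p) powr (2/p)"
    using assms by (intro one_plus_powr_le) auto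
  finally have "sqrt (1 + t\<^sup>2) \<le> sqrt ((1 + t powr p) powr (2/p))"
    by simp
  also have "\<dots> = (1 + t powr p) powr (1/p)"
    by (simp add: powr_half_sqrt[symmetric] powr_powr)
  finally show ?thesis .
qed

text \<open>The power mean inequality, here convexity of \<open>x\<^sup>p\<^sup>/\<^sup>2\<close> at the points \<open>1\<close> and \<open>t\<^sup>2\<close>.\<close>

lemma l2_mean_le_lp_mean:
  fixes p t :: real
  assumes "2 \<le> p" "0 \<le> t"
  shows "sqrt ((1 + t\<^sup>2) / 2) \<le> ((1 + t powr p) / 2) powr (1/p)"
proof -
  have "((1 + t\<^sup>2) / 2) powr (p/2) \<le> (1 powr (p/2) + (t\<^sup>2) powr (p/2)) / 2"
    using assms by (intro powr_half_sum_le) auto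
  also have "(t\<^sup>2) powr (p/2) = t powr p"
    using assms by (cases "t = 0") (auto simp: powr_powr simp flip: powr_numeral)
  finally have "(((1 + t\<^sup>2) / 2) powr (p/2)) powr (1/p) \<le> ((1 + t powr p) / 2) powr (1/p)"
    using assms by (intro powr_mono2) auto
  then show ?thesis
    using assms by (simp add: powr_powr powr_half_sqrt)
qed

section \<open>Means of powers of 1 + s cos\<close>

text \<open>Averaging over the half circle gives the same value as over the full circle, and \<open>cos\<close> is
  injective there, which the evaluation as a Beta integral requires.\<close>

definition cos_mean :: "real \<Rightarrow> real \<Rightarrow> real" where
  "cos_mean a s = integral {0..pi} (\<lambda>\<theta>. (1 + s * cos \<theta>) powr a) / pi"

lemma one_plus_mult_cos_nonneg:
  fixes s \<theta> :: real
  assumes "\<bar>s\<bar> \<le> 1"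
  shows "0 \<le> 1 + s * cos \<theta>"
proof -
  have "\<bar>s * cos \<theta>\<bar> \<le> 1"
    using mult_mono[of "\<bar>s\<bar>" 1 "\<bar>cos \<theta>\<bar>" 1] assms by (simp add: abs_mult)
  then show ?thesis by linarith
qed

lemma integral_cos_reflect:
  fixes h :: "real \<Rightarrow> real"
  shows "integral {0..pi} (\<lambda>\<theta>. h (- cos \<theta>)) = integral {0..pi} (\<lambda>\<theta>. h (cos \<theta>))"
proof -
  have "integral {0..pi} (\<lambda>\<theta>. h (- cos \<theta>)) = integral {-pi..0} (\<lambda>\<theta>. h (- cos (- \<theta>)))"
    using Henstock_Kurzweil_Integration.integral_reflect_real[of pi 0 "\<lambda>\<theta>. h (- cos \<theta>)", symmetric]
    by simp
  also have "\<dots> = integral {-pi..0} ((\<lambda>\<theta>. h (cos \<theta>)) \<circ> (+) pi)"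
    by (simp add: o_def)
  also have "\<dots> = integral {0..pi} (\<lambda>\<theta>. h (cos \<theta>))"
    by (subst integral_shift_Icc_real) simp
  finally show ?thesis .
qed

text \<open>The shift by \<open>\<pi>\<close> carries the lower half circle to the upper one and changes the sign of
  \<open>cos\<close>; the reflection \<open>\<theta> \<mapsto> \<pi> - \<theta>\<close> then shows that both halves contribute equally.\<close>

lemma integral_circle_measure_cos:
  fixes h :: "real \<Rightarrow> real"
  assumes "continuous_on {-1..1} h"
  shows "(\<integral>\<theta>. h (cos \<theta>) \<partial>circle_measure) = integral {0..pi} (\<lambda>\<theta>. h (cos \<theta>)) / pi"
proof -
  have cont: "continuous_on A (\<lambda>\<theta>. h (cos \<theta>))" for A :: "real set"
    by (rule continuous_on_compose2[OF assms]) (auto intro: continuous_intros)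
  then have [measurable]: "(\<lambda>\<theta>. h (cos \<theta>)) \<in> borel_measurable borel"
    by (intro borel_measurable_continuous_onI)
  have dens: "circle_measure = density lborel (\<lambda>x. ennreal (indicator {0..2*pi} x / (2*pi)))"
    unfolding circle_measure_def uniform_measure_def
    by (intro arg_cong[where f = "density lborel"] ext)
       (auto simp: indicator_def divide_ennreal ennreal_1[symmetric] simp del: ennreal_1)
  have "(\<integral>\<theta>. h (cos \<theta>) \<partial>circle_measure)
      = (\<integral>\<theta>. (indicator {0..2*pi} \<theta> / (2*pi)) * h (cos \<theta>) \<partial>lborel)"
    unfolding dens by (subst integral_real_density) auto
  also have "\<dots> = (\<integral>\<theta>. (1 / (2*pi)) * (indicator {0..2*pi} \<theta> * h (cos \<theta>)) \<partial>lborel)"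
    by (intro Bochner_Integration.integral_cong) auto
  also have "\<dots> = (LINT \<theta>:{0..2*pi}|lborel. h (cos \<theta>)) / (2*pi)"
    by (subst integral_mult_right_zero) (simp add: set_lebesgue_integral_def)
  also have "(LINT \<theta>:{0..2*pi}|lborel. h (cos \<theta>)) = integral {0..2*pi} (\<lambda>\<theta>. h (cos \<theta>))"
    by (intro set_borel_integral_eq_integral borel_integrable_atLeastAtMost' cont)
  also have "\<dots> = integral {0..pi} (\<lambda>\<theta>. h (cos \<theta>)) + integral {0+pi..pi+pi} (\<lambda>\<theta>. h (cos \<theta>))"
    by (subst Henstock_Kurzweil_Integration.integral_combine[symmetric, of 0 pi "2*pi"])
       (auto intro: integrable_continuous_real cont)
  also have "integral {0+pi..pi+pi} (\<lambda>\<theta>. h (cos \<theta>)) = integral {0..pi} (\<lambda>\<theta>. h (- cos \<theta>))"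
    by (subst integral_shift_Icc_real[symmetric]) (simp add: o_def add.commute)
  also note integral_cos_reflect
  finally show ?thesis by (simp add: field_simps)
qed

text \<open>Since \<open>1 + s c\<close> is the convex combination of \<open>1 + c\<close> and \<open>1 - c\<close> with weights \<open>(1 + s)/2\<close> and
  \<open>(1 - s)/2\<close>, convexity gives a pointwise bound for \<open>(1 + s c)\<^sup>a\<close>. After integration over \<open>c = cos \<theta>\<close>
  the powers of \<open>1 + c\<close> and \<open>1 - c\<close> have the same integral, so the bound becomes the value at
  \<open>s = 1\<close>. The pointwise bound is an equality at
  \<open>c = 0\<close>, but by continuity strictness at \<open>\<theta> = 0\<close> is enough.\<close>

lemma cos_mean_less:
  assumes a: "1 < a" and s: "0 \<le> s" "s < 1"
  shows "cos_mean a s < cos_mean a 1"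
proof -
  let ?f = "\<lambda>\<theta>. (1 + s * cos \<theta>) powr a"
  let ?g = "\<lambda>\<theta>. (1 + s) / 2 * (1 + cos \<theta>) powr a + (1 - s) / 2 * (1 + - cos \<theta>) powr a"
  have nn: "0 \<le> 1 + cos \<theta>" "0 \<le> 1 - cos \<theta>" for \<theta> :: real
    using cos_ge_minus_one[of \<theta>] cos_le_one[of \<theta>] by linarith+
  have contf: "continuous_on {0..pi} ?f"
    using a s one_plus_mult_cos_nonneg[of s] by (intro continuous_on_powr' continuous_intros) auto
  have cont1: "continuous_on {0..pi} (\<lambda>\<theta>. (1 + cos \<theta>) powr a)"
    using a nn by (intro continuous_on_powr' continuous_intros) auto
  have cont2: "continuous_on {0..pi} (\<lambda>\<theta>. (1 + - cos \<theta>) powr a)"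
    using a nn by (intro continuous_on_powr' continuous_intros) auto
  have contg: "continuous_on {0..pi} ?g"
    by (intro continuous_intros cont1 cont2)
  have le: "?f \<theta> \<le> ?g \<theta>" for \<theta>
  proof -
    have weight: "1 - (1 - s) / 2 = (1 + s) / 2"
      by (simp add: field_simps)
    have "1 + s * cos \<theta> = (1 + s) / 2 * (1 + cos \<theta>) + (1 - s) / 2 * (1 - cos \<theta>)"
      by (simp add: field_simps)
    then show ?thesis
      using convex_onD[OF powr_convex_nonneg[of a], of "(1 - s) / 2" "1 + cos \<theta>" "1 - cos \<theta>", unfolded weight]
        a s nn[of \<theta>] by simp
  qed
  \<comment> \<open>At \<open>\<theta> = 0\<close> the claim is \<open>u\<^sup>a < u\<close> for \<open>u = (1 + s)/2 < 1\<close>, multiplied by \<open>2\<^sup>a\<close>.\<close>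
  have strict: "?f 0 < ?g 0"
  proof -
    have "((1 + s) / 2) powr a < ((1 + s) / 2) powr 1"
      using a s by (intro powr_less_mono') auto
    then have "((1 + s) / 2) powr a * 2 powr a < (1 + s) / 2 * 2 powr a"
      using s by (intro mult_strict_right_mono) auto
    moreover have "((1 + s) / 2) powr a * 2 powr a = (1 + s) powr a"
      using s by (simp add: powr_divide)
    ultimately show ?thesis
      by simp
  qed
  have int: "?f integrable_on {0..pi}" "?g integrable_on {0..pi}"
    by (intro integrable_continuous_real contf contg)+
  have "integral {0..pi} (\<lambda>\<theta>. ?g \<theta> - ?f \<theta>) \<noteq> 0"
  proof
    assume "integral {0..pi} (\<lambda>\<theta>. ?g \<theta> - ?f \<theta>) = 0"
    moreover have "continuous_on {0..pi} (\<lambda>\<theta>. ?g \<theta> - ?f \<theta>)"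
      by (intro continuous_on_diff contf contg)
    ultimately have "\<forall>\<theta>\<in>{0..pi}. ?g \<theta> - ?f \<theta> = 0"
      using le by (subst (asm) integral_eq_0_iff) auto
    then have "?g 0 - ?f 0 = 0"
      by (rule bspec) simp
    then show False
      using strict by linarith
  qed
  moreover have "0 \<le> integral {0..pi} (\<lambda>\<theta>. ?g \<theta> - ?f \<theta>)"
    using le by (intro integral_nonneg integrable_diff int) auto
  ultimately have "integral {0..pi} ?f < integral {0..pi} ?g"
    using integral_diff[OF int(2,1)] by simp
  also have "integral {0..pi} ?g = (1 + s) / 2 * integral {0..pi} (\<lambda>\<theta>. (1 + cos \<theta>) powr a)
      + (1 - s) / 2 * integral {0..pi} (\<lambda>\<theta>. (1 + - cos \<theta>) powr a)"
    using cont1 cont2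
    by (subst Henstock_Kurzweil_Integration.integral_add)
       (auto intro!: integrable_continuous_real continuous_intros)
  also have "\<dots> = integral {0..pi} (\<lambda>\<theta>. (1 + 1 * cos \<theta>) powr a)"
    using integral_cos_reflect[of "\<lambda>x. (1 + x) powr a"] by (simp add: field_simps)
  finally show ?thesis
    by (simp add: cos_mean_def divide_strict_right_mono)
qed

lemma cos_mean_nonneg: "0 \<le> cos_mean a s"
  unfolding cos_mean_def
  by (cases "(\<lambda>\<theta>. (1 + s * cos \<theta>) powr a) integrable_on {0..pi}")
     (auto intro!: divide_nonneg_pos integral_nonneg simp: not_integrable_integral)

lemma cos_mean_le:
  assumes "1 < a" "0 \<le> s" "s \<le> 1"
  shows "cos_mean a s \<le> cos_mean a 1"
  using cos_mean_less[of a s] assms by (cases "s = 1") auto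

lemma continuous_on_cos_mean:
  assumes "0 < a"
  shows "continuous_on {0..1} (cos_mean a)"
proof -
  have "continuous_on ({0..1} \<times> cbox 0 pi) (\<lambda>(s, \<theta>). (1 + s * cos \<theta>) powr a)"
    unfolding case_prod_beta
    using assms by (intro continuous_on_powr' continuous_intros) (auto intro: one_plus_mult_cos_nonneg)
  from integral_continuous_on_param[OF this]
  have "continuous_on {0..1} (\<lambda>s. integral {0..pi} (\<lambda>\<theta>. (1 + s * cos \<theta>) powr a) / pi)"
    by (intro continuous_intros) auto
  then show ?thesis
    by (simp add: cos_mean_def[abs_def])
qed

text \<open>The substitution \<open>u = (1 + cos \<theta>)/2\<close> has \<open>\<bar>du/d\<theta>\<bar> = (sin \<theta>)/2 = (u (1 - u))\<^sup>1\<^sup>/\<^sup>2\<close>, so that it turns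
  the Beta integrand \<open>u\<^sup>a\<^sup>-\<^sup>1\<^sup>/\<^sup>2 (1 - u)\<^sup>-\<^sup>1\<^sup>/\<^sup>2\<close> into \<open>u\<^sup>a\<close>.\<close>

lemma cos_mean_1:
  assumes "0 < a"
  shows "cos_mean a 1 = 2 powr a * (Gamma (a + 1/2) / (sqrt pi * Gamma (a + 1)))"
proof -
  let ?g = "\<lambda>\<theta>::real. (1 + cos \<theta>) / 2"
  let ?f = "\<lambda>u::real. u powr (a + 1/2 - 1) * (1 - u) powr (1/2 - 1)"
  \<comment> \<open>The open interval avoids \<open>\<theta> = 0\<close>, where \<open>1 - u = 0\<close> and the Beta integrand is singular.\<close>
  have img: "?g ` {0<..<pi} = {0<..<1}"
  proof (intro equalityI subsetI)
    fix u assume "u \<in> ?g ` {0<..<pi}"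
    then obtain \<theta> where "0 < \<theta>" "\<theta> < pi" "u = ?g \<theta>"
      by auto
    then show "u \<in> {0<..<1}"
      using cos_monotone_0_pi[of 0 \<theta>] cos_monotone_0_pi[of \<theta> pi] by simp
  next
    fix u :: real assume u: "u \<in> {0<..<1}"
    then show "u \<in> ?g ` {0<..<pi}"
      using arccos_lt_bounded[of "2 * u - 1"]
      by (intro image_eqI[of _ _ "arccos (2 * u - 1)"]) (auto simp: cos_arccos)
  qed
  have half: "sqrt (u * (1 - u)) = u powr (1/2) * (1 - u) powr (1/2)" if "u \<in> {0<..<1}" for u :: real
    using that by (simp add: powr_half_sqrt real_sqrt_mult)
  have combine: "(u powr (1/2) * u powr (a + 1/2 - 1)) * ((1 - u) powr (1/2) * (1 - u) powr (1/2 - 1))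
      = u powr a" if "u \<in> {0<..<1}" for u :: real
    using that unfolding powr_add[symmetric] by simp
  have inj: "inj_on ?g {0<..<pi}"
    by (rule inj_onI, rule cos_inj_pi) auto
  have "(?f has_integral Beta (a + 1/2) (1/2)) {0<..<1}"
    using has_integral_Beta_real[of "a + 1/2" "1/2"] assms by (simp add: has_integral_Icc_iff_Ioo)
  then have f: "?f absolutely_integrable_on (?g ` {0<..<pi})
      \<and> integral (?g ` {0<..<pi}) ?f = Beta (a + 1/2) (1/2)"
    unfolding img by (auto intro!: nonnegative_absolutely_integrable_1 simp: has_integral_iff)
  have "integral {0<..<pi} (\<lambda>\<theta>. \<bar>- sin \<theta> / 2\<bar> * ?f (?g \<theta>)) = Beta (a + 1/2) (1/2)"
  proof -
    have deriv: "(?g has_field_derivative - sin \<theta> / 2) (at \<theta> within {0<..<pi})" for \<theta>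
      by (auto intro!: derivative_eq_intros)
    have meas: "{0<..<pi} \<in> sets lebesgue"
      by simp
    show ?thesis
      using iffD2[OF has_absolute_integral_change_of_variables_1'
          [where g = ?g and g' = "\<lambda>\<theta>. - sin \<theta> / 2" and f = ?f, OF meas deriv inj] f]
      by (rule conjunct2)
  qed
  moreover have "\<bar>- sin \<theta> / 2\<bar> * ?f (?g \<theta>) = (1 + 1 * cos \<theta>) powr a / 2 powr a"
    if "\<theta> \<in> {0<..<pi}" for \<theta>
  proof -
    have u: "?g \<theta> \<in> {0<..<1}"
      using that img by blast
    have sin: "0 < sin \<theta>"
      using that by (simp add: sin_gt_zero)
    have "(sin \<theta> / 2)\<^sup>2 = ?g \<theta> * (1 - ?g \<theta>)"
      by (simp add: power_divide sin_squared_eq) (simp add: field_simps power2_eq_square)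
    then have "sin \<theta> / 2 = sqrt (?g \<theta> * (1 - ?g \<theta>))"
      using sin by (intro real_sqrt_unique[symmetric]) auto
    also have "\<dots> = ?g \<theta> powr (1/2) * (1 - ?g \<theta>) powr (1/2)"
      using u by (rule half)
    finally have "sin \<theta> / 2 * ?f (?g \<theta>)
        = (?g \<theta> powr (1/2) * ?g \<theta> powr (a + 1/2 - 1)) * ((1 - ?g \<theta>) powr (1/2) * (1 - ?g \<theta>) powr (1/2 - 1))"
      by (simp only: mult_ac)
    also have "\<dots> = ?g \<theta> powr a"
      using u by (rule combine)
    also have "\<dots> = (1 + cos \<theta>) powr a / 2 powr a"
      using u by (subst powr_divide) auto
    finally show ?thesis
      using sin by simp
  qed
  ultimately have "integral {0<..<pi} (\<lambda>\<theta>. (1 + 1 * cos \<theta>) powr a / 2 powr a) = Beta (a + 1/2) (1/2)"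
    by (metis (no_types, lifting) Henstock_Kurzweil_Integration.integral_cong)
  then have "integral {0..pi} (\<lambda>\<theta>. (1 + 1 * cos \<theta>) powr a / 2 powr a) = Beta (a + 1/2) (1/2)"
    by (simp add: integral_open_interval_real)
  then have "cos_mean a 1 = 2 powr a * Beta (a + 1/2) (1/2) / pi"
    unfolding cos_mean_def by (simp add: field_simps)
  also have "\<dots> = 2 powr a * (Gamma (a + 1/2) * sqrt pi / Gamma (a + 1)) / (sqrt pi * sqrt pi)"
    by (simp add: Beta_def Gamma_one_half_real add.assoc)
  also have "c * (x * r / y) / (r * r) = c * (x / (r * y))" if "r \<noteq> 0" for c x y r :: real
    using that by simp
  finally show ?thesis by simp
qed

section \<open>The norm on the circle for finite exponents\<close>

lemma norm_one_plus_circle: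
  fixes t \<theta> :: real
  shows "norm (1 + of_real t * exp (\<i> * of_real \<theta>)) = sqrt ((1 + t\<^sup>2) * (1 + 2 * t / (1 + t\<^sup>2) * cos \<theta>))"
proof -
  have pos: "1 + t\<^sup>2 \<noteq> 0"
    by (smt (verit) zero_le_power2)
  have "(norm (1 + of_real t * exp (\<i> * of_real \<theta>)))\<^sup>2 = (1 + t * cos \<theta>)\<^sup>2 + (t * sin \<theta>)\<^sup>2"
    by (simp add: cmod_power2 exp_Euler cos_of_real sin_of_real)
  also have "\<dots> = 1 + 2 * t * cos \<theta> + t\<^sup>2 * ((sin \<theta>)\<^sup>2 + (cos \<theta>)\<^sup>2)"
    by algebra
  also have "\<dots> = (1 + t\<^sup>2) * (1 + 2 * t / (1 + t\<^sup>2) * cos \<theta>)"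
    using pos by (simp add: distrib_left)
  finally show ?thesis
    by (metis norm_ge_zero real_sqrt_unique)
qed

lemma two_mult_div_one_plus_square_le:
  fixes t :: real
  shows "\<bar>2 * t / (1 + t\<^sup>2)\<bar> \<le> 1"
proof -
  have "2 * \<bar>t\<bar> \<le> 1 + t\<^sup>2"
    using zero_le_power2[of "\<bar>t\<bar> - 1"] by (simp add: power2_diff)
  moreover have "0 < 1 + t\<^sup>2"
    by (smt (verit) zero_le_power2)
  ultimately show ?thesis
    by (simp add: abs_mult divide_le_eq)
qed

lemma Lq_norm_circle:
  assumes "0 < q"
  shows "Lq_norm circle_measure (ereal q) (\<lambda>\<theta>. 1 + of_real t * exp (\<i> * of_real \<theta>))
       = sqrt (1 + t\<^sup>2) * cos_mean (q/2) (2 * t / (1 + t\<^sup>2)) powr (1/q)"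
proof -
  define s where "s = 2 * t / (1 + t\<^sup>2)"
  have s: "\<bar>s\<bar> \<le> 1"
    unfolding s_def by (rule two_mult_div_one_plus_square_le)
  have pos: "0 < 1 + t\<^sup>2"
    by (smt (verit) zero_le_power2)
  let ?h = "\<lambda>c. (1 + t\<^sup>2) powr (q/2) * (1 + s * c) powr (q/2)"
  have nn: "0 \<le> 1 + s * c" if "c \<in> {-1..1}" for c
  proof -
    have "\<bar>s * c\<bar> \<le> 1"
      using mult_mono[of "\<bar>s\<bar>" 1 "\<bar>c\<bar>" 1] s that by (auto simp: abs_mult abs_le_iff)
    then show ?thesis by linarith
  qed
  have "(\<integral>\<theta>. norm (1 + of_real t * exp (\<i> * of_real \<theta>)) powr q \<partial>circle_measure)
      = (\<integral>\<theta>. ?h (cos \<theta>) \<partial>circle_measure)"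
    unfolding norm_one_plus_circle s_def[symmetric]
    using pos one_plus_mult_cos_nonneg[OF s]
    by (intro Bochner_Integration.integral_cong refl)
       (simp add: powr_half_sqrt[symmetric] powr_powr powr_mult)
  also have "\<dots> = integral {0..pi} (\<lambda>\<theta>. ?h (cos \<theta>)) / pi"
    using nn assms
    by (intro integral_circle_measure_cos continuous_intros continuous_on_powr') auto
  also have "\<dots> = (1 + t\<^sup>2) powr (q/2) * cos_mean (q/2) s"
    by (simp add: cos_mean_def)
  finally show ?thesis
    unfolding Lq_norm_def s_def[symmetric] using pos assms
    by (simp add: powr_mult powr_powr cos_mean_nonneg powr_half_sqrt)
qed


lemma Lq_norm_circle_le:
  assumes "2 < q" "0 \<le> t" "t \<le> 1"
  shows "Lq_norm circle_measure (ereal q) (\<lambda>\<theta>. 1 + of_real t * exp (\<i> * of_real \<theta>))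
       \<le> sqrt (1 + t\<^sup>2) * cos_mean (q/2) 1 powr (1/q)"
proof -
  have "\<bar>2 * t / (1 + t\<^sup>2)\<bar> \<le> 1" "0 \<le> 2 * t / (1 + t\<^sup>2)"
    using assms two_mult_div_one_plus_square_le[of t] by auto
  then show ?thesis
    using assms
    by (auto simp: Lq_norm_circle intro!: mult_left_mono powr_mono2 cos_mean_le cos_mean_nonneg)
qed

lemma Lq_norm_circle_less:
  assumes "2 < q" "0 \<le> t" "t < 1"
  shows "Lq_norm circle_measure (ereal q) (\<lambda>\<theta>. 1 + of_real t * exp (\<i> * of_real \<theta>))
       < sqrt (1 + t\<^sup>2) * cos_mean (q/2) 1 powr (1/q)"
proof -
  have pos: "0 < 1 + t\<^sup>2"
    by (smt (verit) zero_le_power2)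
  have "0 < (1 - t)\<^sup>2"
    using assms by simp
  then have "2 * t < 1 + t\<^sup>2"
    by (simp add: power2_diff)
  then have "0 \<le> 2 * t / (1 + t\<^sup>2)" "2 * t / (1 + t\<^sup>2) < 1"
    using assms pos by (auto simp: divide_less_eq)
  then have "cos_mean (q/2) (2 * t / (1 + t\<^sup>2)) < cos_mean (q/2) 1"
    using assms by (intro cos_mean_less) auto
  then show ?thesis
    using assms pos
    by (auto simp: Lq_norm_circle intro!: mult_strict_left_mono powr_less_mono2 cos_mean_nonneg)
qed

lemma Lq_norm_circle_1:
  assumes "0 < q"
  shows "Lq_norm circle_measure (ereal q) (\<lambda>\<theta>. 1 + of_real 1 * exp (\<i> * of_real \<theta>))
       = sqrt 2 * cos_mean (q/2) 1 powr (1/q)"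
  using Lq_norm_circle[OF assms, of 1] by simp

lemma continuous_on_Lq_norm_circle:
  assumes "0 < q"
  shows "continuous_on {0..1}
           (\<lambda>t. Lq_norm circle_measure (ereal q) (\<lambda>\<theta>. 1 + of_real t * exp (\<i> * of_real \<theta>)))"
proof -
  have pos: "1 + t\<^sup>2 \<noteq> 0" for t :: real
    by (smt (verit) zero_le_power2)
  have "continuous_on {0..1} (\<lambda>t. cos_mean (q/2) (2 * t / (1 + t\<^sup>2)))"
  proof (rule continuous_on_compose2[OF continuous_on_cos_mean])
    show "(\<lambda>t. 2 * t / (1 + t\<^sup>2)) ` {0..1} \<subseteq> {0..1::real}"
    proof clarify
      fix t :: real assume "t \<in> {0..1}"
      then show "2 * t / (1 + t\<^sup>2) \<in> {0..1}"
        using two_mult_div_one_plus_square_le[of t] by auto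
    qed
  qed (use assms pos in \<open>auto intro!: continuous_intros\<close>)
  then show ?thesis
    unfolding Lq_norm_circle[OF assms] using assms
    by (intro continuous_intros continuous_on_powr') (auto simp: cos_mean_nonneg)
qed

lemma beta_factor_eq_cos_mean:
  assumes "0 < q"
  shows "beta_factor (ereal q) = cos_mean (q/2) 1 powr (1/q) / sqrt 2"
proof -
  define G where "G = Gamma (q/2 + 1/2) / (sqrt pi * Gamma (q/2 + 1))"
  have "0 < G"
    unfolding G_def using assms by (intro divide_pos_pos mult_pos_pos Gamma_real_pos) auto
  then have "cos_mean (q/2) 1 powr (1/q) = sqrt 2 * G powr (1/q)"
    using cos_mean_1[of "q/2"] assms
    by (simp add: G_def[symmetric] powr_mult powr_powr powr_half_sqrt)
  moreover have "beta_factor (ereal q) = G powr (1/q)"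
    by (simp add: beta_factor_def G_def add_divide_distrib)
  ultimately show ?thesis by simp
qed

section \<open>Comparison of alpha and beta\<close>

lemma alpha_eqI:
  assumes "u \<in> {0..1}"
    and "\<And>t. t \<in> {0..1} \<Longrightarrow>
       Lq_norm circle_measure q (\<lambda>\<theta>. 1 + of_real t * exp (\<i> * of_real \<theta>)) / (1 + t powr p) powr (1/p)
     \<le> Lq_norm circle_measure q (\<lambda>\<theta>. 1 + of_real u * exp (\<i> * of_real \<theta>)) / (1 + u powr p) powr (1/p)"
  shows "alpha p q =
     Lq_norm circle_measure q (\<lambda>\<theta>. 1 + of_real u * exp (\<i> * of_real \<theta>)) / (1 + u powr p) powr (1/p)"
  unfolding alpha_def using assms by (intro Greatest_equality) auto

lemma alpha_eq_beta:
  assumes p: "2 \<le> p" and q: "2 < q"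
  shows "alpha p (ereal q) = beta p (ereal q)"
proof -
  define K where "K = cos_mean (q/2) 1 powr (1/q)"
  let ?N = "\<lambda>t. Lq_norm circle_measure (ereal q) (\<lambda>\<theta>. 1 + of_real t * exp (\<i> * of_real \<theta>))"
  have K: "0 \<le> K"
    by (simp add: K_def)
  have N1: "?N 1 = sqrt 2 * K"
    using Lq_norm_circle_1[of q] q by (simp add: K_def)
  have "alpha p (ereal q) = ?N 1 / (1 + 1 powr p) powr (1/p)"
  proof (rule alpha_eqI)
    fix t :: real assume t: "t \<in> {0..1}"
    have pos: "0 < (1 + t powr p) powr (1/p)"
      by (simp add: add_pos_nonneg less_imp_neq[symmetric])
    have "sqrt (1 + t\<^sup>2) \<le> sqrt 2 * ((1 + t powr p) powr (1/p) / 2 powr (1/p))"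
      using l2_mean_le_lp_mean[OF p, of t] t
      by (simp add: real_sqrt_divide powr_divide divide_le_eq mult.commute)
    then have "sqrt (1 + t\<^sup>2) * K \<le> sqrt 2 * ((1 + t powr p) powr (1/p) / 2 powr (1/p)) * K"
      using K by (rule mult_right_mono)
    moreover have "?N t \<le> sqrt (1 + t\<^sup>2) * K"
      using Lq_norm_circle_le[OF q, of t] t by (simp add: K_def)
    ultimately have "?N t \<le> (sqrt 2 * K / 2 powr (1/p)) * (1 + t powr p) powr (1/p)"
      by (simp add: mult_ac)
    then have "?N t / (1 + t powr p) powr (1/p) \<le> sqrt 2 * K / 2 powr (1/p)"
      using pos by (simp add: divide_le_eq)
    then show "?N t / (1 + t powr p) powr (1/p) \<le> ?N 1 / (1 + 1 powr p) powr (1/p)"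
      unfolding N1 by simp
  qed simp
  also have "\<dots> = sqrt 2 * K / 2 powr (1/p)"
    unfolding N1 by simp
  also have "\<dots> = 2 powr (1 - 1/p) * (K / sqrt 2)"
    by (simp add: powr_diff field_simps)
  also have "\<dots> = beta p (ereal q)"
    using p q by (simp add: beta_def beta_factor_eq_cos_mean K_def conj_exponent_def diff_divide_distrib)
  finally show ?thesis .
qed

text \<open>The quotient is bounded strictly by \<open>\<beta>\<close> at each point; the strict bound survives the
  maximum because continuity provides a maximiser.\<close>

lemma alpha_less_beta:
  assumes p: "1 \<le> p" "p < 2" and q: "2 < q"
  shows "alpha p (ereal q) < beta p (ereal q)"
proof -
  define K where "K = cos_mean (q/2) 1 powr (1/q)"
  let ?N = "\<lambda>t. Lq_norm circle_measure (ereal q) (\<lambda>\<theta>. 1 + of_real t * exp (\<i> * of_real \<theta>))"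
  let ?D = "\<lambda>t::real. (1 + t powr p) powr (1/p)"
  have K: "0 < K"
    using cos_mean_less[of "q/2" 0] cos_mean_nonneg[of "q/2" 0] q by (simp add: K_def)
  have D: "0 < ?D t" for t
    by (simp add: add_pos_nonneg less_imp_neq[symmetric])
  have "continuous_on {0..1} (\<lambda>t. ?N t / ?D t)"
    using p q D
    by (intro continuous_intros continuous_on_Lq_norm_circle continuous_on_powr')
       (auto simp: less_imp_neq[symmetric] add_nonneg_eq_0_iff)
  then obtain u where u: "u \<in> {0..1}" "\<And>t. t \<in> {0..1} \<Longrightarrow> ?N t / ?D t \<le> ?N u / ?D u"
    using continuous_attains_sup[of "{0..1::real}" "\<lambda>t. ?N t / ?D t"] by auto
  have "?N u < K * ?D u"
  proof (cases "u = 1")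
    case True
    have "sqrt 2 < 2 powr (1/p)"
      using p powr_less_mono[of "1/2" "1/p" 2] by (simp add: powr_half_sqrt field_simps)
    then have "sqrt 2 * K < 2 powr (1/p) * K"
      using K by (rule mult_strict_right_mono)
    then show ?thesis
      using Lq_norm_circle_1[of q] True q by (simp add: K_def mult.commute)
  next
    case False
    then have "?N u < sqrt (1 + u\<^sup>2) * K"
      using Lq_norm_circle_less[OF q, of u] u(1) by (simp add: K_def)
    also have "\<dots> \<le> ?D u * K"
      using K p u(1) by (intro mult_right_mono l2_norm_le_lp_norm) auto
    finally show ?thesis by (simp add: mult.commute)
  qed
  then have "?N u / ?D u < K"
    using D[of u] by (simp add: divide_less_eq)
  also have "K = beta p (ereal q)"
    using p q by (simp add: beta_def beta_factor_eq_cos_mean K_def conj_exponent_def powr_half_sqrt)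
  finally show ?thesis
    using alpha_eqI[OF u] by simp
qed

lemma prob_space_circle_measure: "prob_space circle_measure"
  unfolding circle_measure_def by (intro prob_space_uniform_measure) auto

text \<open>Only an upper bound for the essential supremum is needed: at \<open>t = 0\<close>, where the function is
  constant, the quotient already reaches the bound \<open>1\<close>.\<close>

lemma alpha_infinity: "alpha 1 \<infinity> = 1"
proof -
  let ?N = "\<lambda>t. Lq_norm circle_measure \<infinity> (\<lambda>\<theta>. 1 + of_real t * exp (\<i> * of_real \<theta>))"
  interpret prob_space circle_measure
    by (rule prob_space_circle_measure)
  have sets [measurable_cong]: "sets circle_measure = sets borel"
    by (simp add: circle_measure_def)
  have upper: "?N t \<le> 1 + t" if "0 \<le> t" for t
  proof -
    let ?f = "\<lambda>\<theta>. ereal (norm (1 + of_real t * exp (\<i> * of_real \<theta>)))"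
    have "norm (1 + of_real t * exp (\<i> * of_real \<theta>)) \<le> 1 + t" for \<theta> :: real
      using norm_triangle_ineq[of 1 "of_real t * exp (\<i> * of_real \<theta>)"] that by (simp add: norm_mult)
    moreover have "?f \<in> borel_measurable circle_measure"
      unfolding measurable_cong_sets[OF sets refl]
      by (intro borel_measurable_ereal borel_measurable_continuous_onI continuous_intros)
    ultimately have "esssup circle_measure ?f \<le> ereal (1 + t)"
      by (intro esssup_I) auto
    then show ?thesis
      using that by (cases "esssup circle_measure ?f") (auto simp: Lq_norm_def)
  qed
  have "?N 0 = 1"
    by (simp add: Lq_norm_def esssup_const emeasure_space_1)
  then show ?thesis
    using upper by (subst alpha_eqI[where u = 0]) (auto simp: divide_le_eq)
qed

theorem proposition1p4:
  fixes d :: nat and p :: real and q :: ereal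
  assumes "d \<ge> 1"
    and "1 \<le> p" and "ereal p < q"
    and "q = ereal ((real d + 2) / real d) * conj_exponent p"
  shows "(p \<ge> 2 \<longrightarrow> alpha p q = beta p q) \<and> (p < 2 \<longrightarrow> alpha p q < beta p q)"
proof (cases "p = 1")
  case True
  then have "q = \<infinity>"
    using assms by (simp add: conj_exponent_def)
  moreover have "1 < sqrt (2::real)"
    by simp
  ultimately show ?thesis
    using True
    by (simp add: alpha_infinity beta_def beta_factor_def conj_exponent_def powr_half_sqrt)
next
  case False
  define r where "r = (real d + 2) / real d * (p / (p - 1))"
  have p: "1 < p" and q: "q = ereal r"
    using False assms by (auto simp: conj_exponent_def r_def)
  \<comment> \<open>If \<open>p < 2\<close>, then \<open>p' > 2\<close> and the factor \<open>(d + 2)/d\<close> exceeds \<open>1\<close>; otherwise \<open>q > p \<ge> 2\<close>.\<close>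
  have "2 < r"
  proof (cases "p < 2")
    case True
    then have "2 < p / (p - 1)" "1 < (real d + 2) / real d"
      using p assms(1) by (auto simp: field_simps)
    then have "1 * 2 < r"
      unfolding r_def by (intro mult_strict_mono) auto
    then show ?thesis by simp
  next
    case False
    then show ?thesis
      using assms(3) q by simp
  qed
  then show ?thesis
    using alpha_eq_beta[of p r] alpha_less_beta[of p r] p q by auto
qed

end
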